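(* For every integer $k \geq 2$ there is an undirected Cayley graph on four generators of a cyclic group which has diameter $k$ and order $L(8,k)$, where \[ L(8,k)= \begin{cases} (k^4+2k^3+6k^2+4k)/2 &\mbox{ if } k\equiv 0 \pmod 2,\\ (k^4+2k^3+6k^2+6k+1)/2 &\mbox{ if } k\equiv 1 \pmod 2. \end{cases} \] Moreover, such a graph is the Cayley graph of $\mathbb{Z}_{L(8,k)}$ with generator set $\{1,\ (k^3+2k^2+6k+2)/2,\ (k^4+4k^2-8k)/4,\ (k^4+4k^2-4k)/4\}$ when $k \equiv 0 \pmod 2$, and with generator set $\{1,\ (k^3+k^2+5k+3)/2,\ (k^4+2k^2-8k-11)/4,\ (k^4+2k^2-4k-7)/4\}$ when $k \equiv 1 \pmod 2$.
   Context: For a positive integer $n$ and elements $g_1,\dots,g_4 \in \mathbb{Z}_n$ (the cyclic group of integers modulo $n$), the undirected Cayley graph (circulant graph) of $\mathbb{Z}_n$ with generator set $\{g_1,\dots,g_4\}$ has vertex set $\mathbb{Z}_n$, with vertices $x$ and $y$ adjacent whenever $y - x \in \{\pm g_1, \pm g_2, \pm g_3, \pm g_4\}$. Its order is $n$, and its diameter is the maximum over all pairs of vertices of the length of a shortest path between them. *)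

theory Defs
  imports "Graph_Theory.Shortest_Path" "HOL-Algebra.Elementary_Groups"
begin

text \<open>
  Undirected graphs are represented as symmetric digraphs. Written additively, the arc condition
  says that \<open>y - x\<close> is \<open>g\<close> or \<open>- g\<close> for some \<open>g\<close> in \<open>S\<close>.
\<close>

definition cayley_graph :: "('a, 'm) monoid_scheme \<Rightarrow> 'a set \<Rightarrow> ('a, 'a \<times> 'a) pre_digraph" where
  "cayley_graph G S =
    \<lparr>verts = carrier G,
     arcs = {(x, y). x \<in> carrier G \<and> y \<in> carrier G \<and>
                     inv\<^bsub>G\<^esub> x \<otimes>\<^bsub>G\<^esub> y \<in> S \<union> m_inv G ` S},
     tail = fst,
     head = snd\<rparr>"

lemma wf_digraph_cayley_graph: "wf_digraph (cayley_graph G S)"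
  by unfold_locales (auto simp: cayley_graph_def)

lemma symmetric_cayley_graph:
  fixes G (structure)
  assumes "group G" "S \<subseteq> carrier G"
  shows "symmetric (cayley_graph G S)"
proof -
  interpret group G by fact
  have "inv y \<otimes> x \<in> S \<union> m_inv G ` S"
    if "x \<in> carrier G" "y \<in> carrier G" "inv x \<otimes> y \<in> S \<union> m_inv G ` S" for x y
  proof -
    have eq: "inv y \<otimes> x = inv (inv x \<otimes> y)"
      using that by (simp add: inv_mult_group)
    from that(3) show ?thesis
      unfolding eq using assms(2) by force
  qed
  then show ?thesis
    by (auto simp: symmetric_def sym_def arcs_ends_def arc_to_ends_def cayley_graph_def)
qed

text \<open>
  With unit arc costs, \<open>wf_digraph.\<mu>\<close> is the length of a shortest walk, and \<open>\<infinity>\<close> if there is none;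
  hence a disconnected graph has diameter \<open>\<infinity>\<close>.
\<close>

definition graph_diameter :: "('a, 'b) pre_digraph \<Rightarrow> ereal" where
  "graph_diameter G = (SUP u\<in>verts G. SUP v\<in>verts G. wf_digraph.\<mu> G (\<lambda>_. 1) u v)"

definition L8 :: "nat \<Rightarrow> nat" where
  "L8 k =
    (if even k then (k^4 + 2*k^3 + 6*k^2 + 4*k) div 2
     else (k^4 + 2*k^3 + 6*k^2 + 6*k + 1) div 2)"

definition gens8 :: "nat \<Rightarrow> int set" where
  "gens8 k =
    (let k = int k in
     if even k then
       {1,
        (k^3 + 2*k^2 + 6*k + 2) div 2,
        (k^4 + 4*k^2 - 8*k) div 4,
        (k^4 + 4*k^2 - 4*k) div 4}
     else
       {1,
        (k^3 + k^2 + 5*k + 3) div 2,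
        (k^4 + 2*k^2 - 8*k - 11) div 4,
        (k^4 + 2*k^2 - 4*k - 7) div 4})"

text \<open>All divisions in \<open>L8\<close> and \<open>gens8\<close> are exact.\<close>

lemma L8_exact:
  "2 * L8 k =
    (if even k then k^4 + 2*k^3 + 6*k^2 + 4*k
     else k^4 + 2*k^3 + 6*k^2 + 6*k + 1)"
  by (simp add: L8_def)

lemma gens8_exact_even:
  fixes k :: int
  assumes "even k"
  shows "2 dvd k^3 + 2*k^2 + 6*k + 2" "4 dvd k^4 + 4*k^2 - 8*k" "4 dvd k^4 + 4*k^2 - 4*k"
proof -
  from assms obtain m where "k = 2 * m" ..
  then have "k^3 + 2*k^2 + 6*k + 2 = 2 * (4*m^3 + 4*m^2 + 6*m + 1)"
    "k^4 + 4*k^2 - 8*k = 4 * (4*m^4 + 4*m^2 - 4*m)"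
    "k^4 + 4*k^2 - 4*k = 4 * (4*m^4 + 4*m^2 - 2*m)"
    by (simp_all add: power_mult_distrib)
  then show "2 dvd k^3 + 2*k^2 + 6*k + 2" "4 dvd k^4 + 4*k^2 - 8*k" "4 dvd k^4 + 4*k^2 - 4*k"
    by (metis dvd_triv_left)+
qed

lemma gens8_exact_odd:
  fixes k :: int
  assumes "odd k"
  shows "2 dvd k^3 + k^2 + 5*k + 3" "4 dvd k^4 + 2*k^2 - 8*k - 11" "4 dvd k^4 + 2*k^2 - 4*k - 7"
proof -
  from assms obtain m where "k = 2 * m + 1" ..
  then have "k^3 + k^2 + 5*k + 3 = 2 * (4*m^3 + 8*m^2 + 10*m + 5)"
    "k^4 + 2*k^2 - 8*k - 11 = 4 * (4*m^4 + 8*m^3 + 8*m^2 - 4)"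
    "k^4 + 2*k^2 - 4*k - 7 = 4 * (4*m^4 + 8*m^3 + 8*m^2 + 2*m - 2)"
    by algebra+
  then show "2 dvd k^3 + k^2 + 5*k + 3" "4 dvd k^4 + 2*k^2 - 8*k - 11" "4 dvd k^4 + 2*k^2 - 4*k - 7"
    by (metis dvd_triv_left)+
qed

end

theory Submission
  imports Defs "HOL-Number_Theory.Cong"
begin

text \<open>
  Put \<open>M = k/2\<close> for even \<open>k\<close> and \<open>M = -(k + 1)/2\<close> for odd \<open>k\<close>. Up to a common sign of the last three
  generators, both parities then become one family in \<open>M\<close>, and the integer vectors of coefficients
  representing \<open>0\<close> form the lattice spanned by
  \<open>e1 = (2M, 0, 1, -1)\<close>, \<open>e2 = (0, 2M, -1, 1)\<close>, \<open>e3 = (-1, 1, 2M + 1, 1)\<close>,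
  \<open>e4 = (1, -1, -1, 2M + 1)\<close> and \<open>h = (e1 + e2 + e3 + e4)/2 = (M, M, M, M + 1)\<close>,
  a slight perturbation of a body-centred cubic lattice. The diameter is the covering radius of this lattice
  in the \<open>l1\<close> norm.

  In the unperturbed lattice a point of the box \<open>\<bar>x_i\<bar> \<le> \<bar>M\<bar>\<close> of norm \<open>r\<close> is at distance \<open>4\<bar>M\<bar> - r\<close> from the
  vertex of the box in its orthant, so one of the two distances is at most \<open>2\<bar>M\<bar>\<close>; comparing an \<open>l1\<close>-minimal
  representative with its translates by the neighbours of the origin makes this exact. Conversely
  the coset of \<open>(e1 + e2)/2\<close> contains no vector of norm less than \<open>k\<close>.
\<close>

section \<open>Walks in circulant graphs as integer combinations of generators\<close>

lemma cayley_graph_sel: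
  "verts (cayley_graph G S) = carrier G" "tail (cayley_graph G S) = fst"
  "head (cayley_graph G S) = snd"
  by (simp_all add: cayley_graph_def)

lemma arc_circulant_iff:
  assumes "0 < n" "S \<subseteq> {0..<int n}"
  shows "(x, y) \<in> arcs (cayley_graph (integer_mod_group n) S) \<longleftrightarrow>
    x \<in> {0..<int n} \<and> y \<in> {0..<int n} \<and>
    (\<exists>g\<in>S. [y = x + g] (mod int n) \<or> [y = x - g] (mod int n))"
proof -
  let ?G = "integer_mod_group n"
  have "inv\<^bsub>?G\<^esub> x \<otimes>\<^bsub>?G\<^esub> y \<in> S \<union> m_inv ?G ` S \<longleftrightarrow>
      (\<exists>g\<in>S. [y = x + g] (mod int n) \<or> [y = x - g] (mod int n))"
    if x: "x \<in> {0..<int n}" and y: "y \<in> {0..<int n}"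
  proof -
    have car: "carrier ?G = {0..<int n}" using assms by (simp add: carrier_integer_mod_group)
    have inv: "m_inv ?G ` S = (\<lambda>g. (- g) mod int n) ` S"
      using assms(2) by (intro image_cong) (auto simp: car)
    have diff: "inv\<^bsub>?G\<^esub> x \<otimes>\<^bsub>?G\<^esub> y = (y - x) mod int n"
      using x by (simp add: car mod_simps)
    have pos: "(y - x) mod int n = g \<longleftrightarrow> [y = x + g] (mod int n)" if "g \<in> S" for g
    proof -
      have "g mod int n = g" using that assms(2) by (auto intro: mod_pos_pos_trivial)
      then have "(y - x) mod int n = g \<longleftrightarrow> [y - x = g] (mod int n)" by (simp add: cong_def)
      also have "\<dots> \<longleftrightarrow> [y = x + g] (mod int n)"
        by (simp add: cong_iff_dvd_diff algebra_simps)
      finally show ?thesis .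
    qed
    have neg: "(y - x) mod int n = (- g) mod int n \<longleftrightarrow> [y = x - g] (mod int n)" for g
      unfolding cong_def[symmetric] by (simp add: cong_iff_dvd_diff algebra_simps)
    show ?thesis
      unfolding diff inv using pos neg by (auto simp: image_iff)
  qed
  then show ?thesis
    using assms by (auto simp: cayley_graph_def carrier_integer_mod_group)
qed

text \<open>As the group is abelian, only the signed number of uses of each generator matters.
  Opposite steps cancel, so the norm of \<open>c\<close> may be smaller than the length of the
  walk.\<close>

lemma circulant_awalk_imp_combination:
  assumes "0 < n" "S \<subseteq> {0..<int n}"
    and "pre_digraph.awalk (cayley_graph (integer_mod_group n) S) u p v"
  shows "\<exists>c. (\<Sum>g\<in>S. \<bar>c g\<bar>) \<le> int (length p) \<and> [v = u + (\<Sum>g\<in>S. c g * g)] (mod int n)"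
  using assms(3)
proof (induction p arbitrary: u)
  let ?G = "cayley_graph (integer_mod_group n) S"
  interpret wf_digraph ?G by (rule wf_digraph_cayley_graph)
  case Nil
  then show ?case by (intro exI[of _ "\<lambda>_. 0"]) (auto simp: awalk_def)
next
  let ?G = "cayley_graph (integer_mod_group n) S"
  interpret wf_digraph ?G by (rule wf_digraph_cayley_graph)
  have fin: "finite S" using assms(2) finite_subset by blast
  case (Cons e p)
  obtain x y where e: "e = (x, y)" by fastforce
  have arc: "(u, y) \<in> arcs ?G" and walk: "awalk y p v"
    using Cons.prems by (auto simp: awalk_Cons_iff e cayley_graph_sel)
  obtain g and s :: int where g: "g \<in> S" and s: "\<bar>s\<bar> = 1" and y: "[y = u + s * g] (mod int n)"
  proof -
    obtain g where "g \<in> S" "[y = u + g] (mod int n) \<or> [y = u - g] (mod int n)"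
      using arc unfolding arc_circulant_iff[OF assms(1,2)] by blast
    then show thesis using that[of g 1] that[of g "-1"] by auto
  qed
  obtain c where c: "(\<Sum>h\<in>S. \<bar>c h\<bar>) \<le> int (length p)"
    and v: "[v = y + (\<Sum>h\<in>S. c h * h)] (mod int n)"
    using Cons.IH[OF walk] by blast
  let ?c = "c(g := c g + s)"
  have "(\<Sum>h\<in>S. \<bar>?c h\<bar>) = \<bar>c g + s\<bar> + (\<Sum>h\<in>S - {g}. \<bar>c h\<bar>)"
    by (subst sum.remove[OF fin g]) (auto intro!: sum.cong)
  also have "\<dots> \<le> 1 + (\<bar>c g\<bar> + (\<Sum>h\<in>S - {g}. \<bar>c h\<bar>))" using s by linarith
  also have "\<dots> = 1 + (\<Sum>h\<in>S. \<bar>c h\<bar>)" by (simp add: sum.remove[OF fin g])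
  finally have "(\<Sum>h\<in>S. \<bar>?c h\<bar>) \<le> int (length (e # p))" using c by simp
  moreover have "[v = u + (\<Sum>h\<in>S. ?c h * h)] (mod int n)"
  proof -
    have "(\<Sum>h\<in>S. ?c h * h) = (c g + s) * g + (\<Sum>h\<in>S - {g}. c h * h)"
      by (subst sum.remove[OF fin g]) (auto intro!: sum.cong)
    also have "\<dots> = s * g + (\<Sum>h\<in>S. c h * h)"
      by (simp add: sum.remove[OF fin g] algebra_simps)
    finally have "u + (\<Sum>h\<in>S. ?c h * h) = (u + s * g) + (\<Sum>h\<in>S. c h * h)" by simp
    moreover have "[v = (u + s * g) + (\<Sum>h\<in>S. c h * h)] (mod int n)"
      using v y by (meson cong_add cong_refl cong_trans)
    ultimately show ?thesis by (simp add: add.assoc)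
  qed
  ultimately show ?case by blast
qed

text \<open>Induction on the norm: a step by a generator with nonzero coefficient, in the direction
  of its sign, lowers the norm by exactly one.\<close>

lemma combination_imp_circulant_awalk:
  fixes c :: "int \<Rightarrow> int"
  assumes "0 < n" "S \<subseteq> {0..<int n}" "u \<in> {0..<int n}" "v \<in> {0..<int n}"
    and "(\<Sum>g\<in>S. \<bar>c g\<bar>) = int l" "[v = u + (\<Sum>g\<in>S. c g * g)] (mod int n)"
  shows "\<exists>p. pre_digraph.awalk (cayley_graph (integer_mod_group n) S) u p v \<and> length p = l"
  using assms(3-6)
proof (induction l arbitrary: u c)
  let ?G = "cayley_graph (integer_mod_group n) S"
  interpret wf_digraph ?G by (rule wf_digraph_cayley_graph)
  have fin: "finite S" using assms(2) finite_subset by blast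
  case 0
  then have "\<forall>g\<in>S. c g = 0" using fin by (simp add: sum_nonneg_eq_0_iff)
  then have "[v = u] (mod int n)" using 0 by simp
  then have "v = u" using 0 by (auto simp: cong_def)
  then have "awalk u [] v"
    using 0 assms(1) by (simp add: awalk_def cayley_graph_sel carrier_integer_mod_group)
  then show ?case by auto
next
  let ?G = "cayley_graph (integer_mod_group n) S"
  interpret wf_digraph ?G by (rule wf_digraph_cayley_graph)
  have fin: "finite S" using assms(2) finite_subset by blast
  case (Suc l)
  obtain g where g: "g \<in> S" "c g \<noteq> 0"
  proof -
    have "\<exists>g\<in>S. c g \<noteq> 0" using Suc.prems(3) by (force intro: ccontr)
    then show thesis using that by blast
  qed
  define s where "s = sgn (c g)"
  define c' where "c' = c(g := c g - s)"
  define y where "y = (u + s * g) mod int n"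
  have s: "s = 1 \<or> s = -1" using g(2) by (auto simp: s_def sgn_if)
  have y: "y \<in> {0..<int n}" using assms(1) by (simp add: y_def)
  have ycong: "[y = u + s * g] (mod int n)" by (simp add: y_def cong_def)
  have "(\<Sum>h\<in>S. \<bar>c' h\<bar>) = \<bar>c g - s\<bar> + (\<Sum>h\<in>S - {g}. \<bar>c h\<bar>)"
    unfolding c'_def by (subst sum.remove[OF fin g(1)]) (auto intro!: sum.cong)
  moreover have "(\<Sum>h\<in>S. \<bar>c h\<bar>) = \<bar>c g\<bar> + (\<Sum>h\<in>S - {g}. \<bar>c h\<bar>)"
    by (rule sum.remove[OF fin g(1)])
  moreover have "\<bar>c g - s\<bar> = \<bar>c g\<bar> - 1" using g(2) by (auto simp: s_def sgn_if)
  ultimately have norm: "(\<Sum>h\<in>S. \<bar>c' h\<bar>) = int l" using Suc.prems(3) by simp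
  have "(\<Sum>h\<in>S. c' h * h) = (c g - s) * g + (\<Sum>h\<in>S - {g}. c h * h)"
    unfolding c'_def by (subst sum.remove[OF fin g(1)]) (auto intro!: sum.cong)
  moreover have "(\<Sum>h\<in>S. c h * h) = c g * g + (\<Sum>h\<in>S - {g}. c h * h)"
    by (rule sum.remove[OF fin g(1)])
  ultimately have "u + (\<Sum>h\<in>S. c h * h) = (u + s * g) + (\<Sum>h\<in>S. c' h * h)"
    by (simp add: algebra_simps)
  then have "[v = (u + s * g) + (\<Sum>h\<in>S. c' h * h)] (mod int n)"
    using Suc.prems(4) by (simp add: add.assoc)
  then have "[v = y + (\<Sum>h\<in>S. c' h * h)] (mod int n)"
    using ycong by (meson cong_add cong_refl cong_sym cong_trans)
  then obtain p where p: "awalk y p v" "length p = l"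
    using Suc.IH[OF y Suc.prems(2) norm] by blast
  have "(u, y) \<in> arcs ?G"
    unfolding arc_circulant_iff[OF assms(1,2)] using Suc.prems(1) y g(1) s ycong by auto
  then have "awalk u ((u, y) # p) v"
    using p by (simp add: awalk_Cons_iff cayley_graph_sel)
  then show ?case using p(2) by (intro exI[of _ "(u, y) # p"]) simp
qed

text \<open>A walk from \<open>u\<close> to \<open>v\<close> depends only on \<open>v - u\<close>,
  so distances are minimal norms of combinations representing a residue. The hypothesis
  \<open>upper\<close> bounds all of them, and \<open>lower\<close> shows that the pair
  \<open>0\<close>, \<open>w mod int n\<close> attains \<open>k\<close>.\<close>

lemma graph_diameter_circulantI:
  assumes n: "0 < n" and S: "S \<subseteq> {0..<int n}"
    and upper: "\<And>z. \<exists>c. (\<Sum>g\<in>S. \<bar>c g\<bar>) \<le> int k \<and> [z = (\<Sum>g\<in>S. c g * g)] (mod int n)"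
    and lower: "\<And>c. [w = (\<Sum>g\<in>S. c g * g)] (mod int n) \<Longrightarrow> int k \<le> (\<Sum>g\<in>S. \<bar>c g\<bar>)"
  shows "graph_diameter (cayley_graph (integer_mod_group n) S) = ereal (real k)"
proof -
  let ?G = "cayley_graph (integer_mod_group n) S"
  interpret wf_digraph ?G by (rule wf_digraph_cayley_graph)
  have verts: "verts ?G = {0..<int n}"
    using n by (simp add: cayley_graph_sel carrier_integer_mod_group)
  have cost: "awalk_cost (\<lambda>_. 1) p = real (length p)" for p :: "(int \<times> int) list"
    by (induction p) auto
  have le: "\<mu> (\<lambda>_. 1) u v \<le> ereal (real k)" if u: "u \<in> verts ?G" and v: "v \<in> verts ?G" for u v
  proof -
    obtain c where c: "(\<Sum>g\<in>S. \<bar>c g\<bar>) \<le> int k" "[v - u = (\<Sum>g\<in>S. c g * g)] (mod int n)"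
      using upper by blast
    have "[v = u + (\<Sum>g\<in>S. c g * g)] (mod int n)"
      using c(2) by (simp add: cong_iff_dvd_diff algebra_simps)
    moreover have "(\<Sum>g\<in>S. \<bar>c g\<bar>) = int (nat (\<Sum>g\<in>S. \<bar>c g\<bar>))" by (simp add: sum_nonneg)
    ultimately obtain p where "awalk u p v" "length p = nat (\<Sum>g\<in>S. \<bar>c g\<bar>)"
      using combination_imp_circulant_awalk[OF n S] u v unfolding verts by metis
    then have "\<mu> (\<lambda>_. 1) u v \<le> ereal (real (length p))" "length p \<le> k"
      using min_cost_le_walk_cost[of u p v "\<lambda>_. 1"] c(1) by (auto simp: cost)
    then show ?thesis by (metis ereal_less_eq(3) of_nat_le_iff order_trans)
  qed
  have ge: "ereal (real k) \<le> \<mu> (\<lambda>_. 1) 0 (w mod int n)"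
    unfolding \<mu>_def
  proof (rule INF_greatest)
    fix p assume "p \<in> {p. awalk 0 p (w mod int n)}"
    then obtain c where c: "(\<Sum>g\<in>S. \<bar>c g\<bar>) \<le> int (length p)"
      "[w mod int n = 0 + (\<Sum>g\<in>S. c g * g)] (mod int n)"
      using circulant_awalk_imp_combination[OF n S] by blast
    then have "k \<le> length p" using lower[of c] by (simp add: cong_def)
    then show "ereal (real k) \<le> ereal (awalk_cost (\<lambda>_. 1) p)" by (simp add: cost)
  qed
  show ?thesis unfolding graph_diameter_def
  proof (rule antisym)
    show "(SUP u\<in>verts ?G. SUP v\<in>verts ?G. \<mu> (\<lambda>_. 1) u v) \<le> ereal (real k)"
      using le by (intro SUP_least)
    have "0 \<in> verts ?G" "w mod int n \<in> verts ?G" using n by (auto simp: verts)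
    then show "ereal (real k) \<le> (SUP u\<in>verts ?G. SUP v\<in>verts ?G. \<mu> (\<lambda>_. 1) u v)"
      using ge by (meson SUP_upper2)
  qed
qed

section \<open>The one-parameter family and its lattice of relations\<close>

text \<open>This polynomial takes the value \<open>L8 k\<close> both at \<open>M = k/2\<close> for
  even \<open>k\<close> and at \<open>M = -(k + 1)/2\<close> for odd \<open>k\<close>.\<close>

definition circ_order :: "int \<Rightarrow> int" where
  "circ_order M = 8*M^4 + 8*M^3 + 12*M^2 + 4*M"

definition circ_val :: "int \<Rightarrow> int \<Rightarrow> int \<Rightarrow> int \<Rightarrow> int \<Rightarrow> int" where
  "circ_val M x1 x2 x3 x4 = x1 + (4*M^3 + 4*M^2 + 6*M + 1)*x2
     + (4*M^4 + 4*M^2 - 4*M)*x3 + (4*M^4 + 4*M^2 - 2*M)*x4"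

text \<open>The shift is by the lattice vector \<open>c1 e1 + c2 e2 + c3 e3 + c4 h\<close>.\<close>

lemma circ_val_shift:
  "circ_val M (x1 + 2*M*c1 - c3 + M*c4) (x2 + 2*M*c2 + c3 + M*c4)
      (x3 + c1 - c2 + (2*M + 1)*c3 + M*c4) (x4 - c1 + c2 + c3 + (M + 1)*c4)
    = circ_val M x1 x2 x3 x4 + circ_order M * (c2 + M*c3 + M*c4)"
  unfolding circ_val_def circ_order_def by algebra

text \<open>Converse of \<open>circ_val_shift\<close>: the kernel of \<open>circ_val\<close> modulo
  \<open>circ_order\<close> is no larger than the lattice spanned by \<open>e1\<close>,
  \<open>e2\<close>, \<open>e3\<close>, \<open>h\<close>.\<close>

lemma kernel_coefficients:
  assumes "circ_val M v1 v2 v3 v4 = circ_order M * t"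
  obtains c1 c2 c3 c4 where
    "v1 = 2*M*c1 - c3 + M*c4" "v2 = 2*M*c2 + c3 + M*c4"
    "v3 = c1 - c2 + (2*M + 1)*c3 + M*c4" "v4 = - c1 + c2 + c3 + (M + 1)*c4"
proof -
  \<comment> \<open>\<open>circ_val_shift\<close> forces \<open>t = c2 + M*c3 + M*c4\<close>.
    Eliminating \<open>c1\<close> and \<open>c2\<close> leaves
    \<open>(1 - 2*M^2)*c3 + (M - 2*M^2)*c4 = v2 - 2*M*t\<close> and
    \<open>(2*M + 2)*c3 + (2*M + 1)*c4 = v3 + v4\<close>, of determinant 1, so Cramer's rule gives
    integers.\<close>
  define c3 where "c3 = (2*M + 1)*(v2 - 2*M*t) - (M - 2*M^2)*(v3 + v4)"
  define c4 where "c4 = (1 - 2*M^2)*(v3 + v4) - (2*M + 2)*(v2 - 2*M*t)"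
  define c2 where "c2 = t - M*c3 - M*c4"
  define c1 where "c1 = v3 + c2 - (2*M + 1)*c3 - M*c4"
  have v2: "v2 = 2*M*c2 + c3 + M*c4"
    unfolding c2_def c3_def c4_def by algebra
  have v3: "v3 = c1 - c2 + (2*M + 1)*c3 + M*c4"
    unfolding c1_def by simp
  have v4: "v4 = - c1 + c2 + c3 + (M + 1)*c4"
    unfolding c1_def c3_def c4_def by algebra
  \<comment> \<open>The first coordinate has coefficient 1 in \<open>circ_val\<close>, so the other
    three and the value determine it.\<close>
  have "circ_val M (2*M*c1 - c3 + M*c4) v2 v3 v4 = circ_order M * t"
    using circ_val_shift[of M 0 c1 c3 c4 0 c2 0 0] v2 v3 v4
    by (simp add: c2_def circ_val_def[of M 0 0 0 0])
  with assms have "v1 = 2*M*c1 - c3 + M*c4"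
    by (simp add: circ_val_def)
  from that[OF this v2 v3 v4] show thesis .
qed

section \<open>Lower bound: a coset without short vectors\<close>

lemma abs_mult_le_sum4:
  fixes a b x y z t :: "'a::linordered_idom"
  assumes "a * b = x + y + z + t"
  shows "\<bar>a\<bar> * \<bar>b\<bar> \<le> \<bar>x\<bar> + \<bar>y\<bar> + \<bar>z\<bar> + \<bar>t\<bar>"
proof -
  have "\<bar>x + y + z + t\<bar> \<le> \<bar>x\<bar> + \<bar>y\<bar> + \<bar>z\<bar> + \<bar>t\<bar>"
    by (intro order_trans[OF abs_triangle_ineq] add_right_mono) simp
  then show ?thesis by (simp only: assms flip: abs_mult)
qed

text \<open>
  The vectors \<open>y = (d1 e1 + d2 e2 + d3 e3 + d4 e4)/2\<close> with these parities form the coset of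
  \<open>(M, M, 0, 0) = (e1 + e2)/2\<close>. The sums and differences \<open>y1 \<plusminus> y2\<close> and \<open>y3 \<plusminus> y4\<close>
  almost decouple the four coefficients.
\<close>

lemma half_lattice_norm_ge:
  fixes M k d1 d2 d3 d4 y1 y2 y3 y4 :: int
  assumes M: "2 \<le> M \<and> k = 2*M \<or> M \<le> -2 \<and> k = -2*M - 1"
    and y1: "2*y1 = 2*M*d1 - d3 + d4" and y2: "2*y2 = 2*M*d2 + d3 - d4"
    and y3: "2*y3 = d1 - d2 + (2*M + 1)*d3 - d4" and y4: "2*y4 = d2 - d1 + d3 + (2*M + 1)*d4"
    and par: "odd d1 \<and> odd d2 \<and> even d3 \<and> even d4 \<or> even d1 \<and> even d2 \<and> odd d3 \<and> odd d4"
  shows "k \<le> \<bar>y1\<bar> + \<bar>y2\<bar> + \<bar>y3\<bar> + \<bar>y4\<bar>"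
proof -
  define u w p q where "u = \<bar>d1 + d2\<bar>" and "w = \<bar>d1 - d2\<bar>"
    and "p = \<bar>d3 + d4\<bar>" and "q = \<bar>d3 - d4\<bar>"
  define m L where "m = \<bar>M\<bar>" and "L = \<bar>2*M + 1\<bar>"
  define Y Z where "Y = \<bar>y1\<bar> + \<bar>y2\<bar>" and "Z = \<bar>y3\<bar> + \<bar>y4\<bar>"
  note defs = u_def w_def p_def q_def
  have nonneg: "0 \<le> u" "0 \<le> w" "0 \<le> p" "0 \<le> q" "0 \<le> Y" "0 \<le> Z"
    by (simp_all add: defs Y_def Z_def)
  have ev: "even u" "even w" "even p" "even q"
    using par by (auto simp: defs)
  \<comment> \<open>The last bound serves the cases with \<open>p < q\<close> and
    \<open>2 \<le> w\<close>: there twice \<open>Y2\<close> plus \<open>Z2\<close> gives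
    \<open>2*Y + 2*Z \<ge> 2*(m*w - w) + (L*q - 3*q) + 2\<close>, which is at least
    \<open>4*m + 2*L - 8\<close>. It fails for \<open>M = 1\<close>.\<close>
  have mL: "2 \<le> m" "3 \<le> L" "k \<le> 2*m" "k \<le> L" "2*k \<le> 4*m + 2*L - 8"
    using M by (auto simp: m_def L_def)
  have Y1: "m*u \<le> Y"
  proof -
    have "M*(d1 + d2) = y1 + y2 + 0 + 0" using y1 y2 by algebra
    from abs_mult_le_sum4[OF this] show ?thesis by (simp add: m_def u_def Y_def)
  qed
  have Y2: "m*w \<le> Y + q"
  proof -
    have "M*(d1 - d2) = y1 + (- y2) + (d3 - d4) + 0" using y1 y2 by algebra
    from abs_mult_le_sum4[OF this] show ?thesis by (simp add: m_def w_def q_def Y_def)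
  qed
  have Z1: "L*p \<le> 2*Z + q"
  proof -
    have "(2*M + 1)*(d3 + d4) = 2*y3 + 2*y4 + (- (d3 - d4)) + 0" using y3 y4 by algebra
    from abs_mult_le_sum4[OF this] show ?thesis
      by (simp only: abs_mult abs_minus_cancel abs_numeral abs_zero L_def p_def q_def Z_def
          distrib_left add_0_right)
  qed
  have Z2: "L*q \<le> 2*Z + 2*w + p"
  proof -
    have "(2*M + 1)*(d3 - d4) = 2*y3 + (- 2)*y4 + (- 2)*(d1 - d2) + (d3 + d4)" using y3 y4 by algebra
    from abs_mult_le_sum4[OF this] show ?thesis
      by (simp only: abs_mult abs_minus_cancel abs_numeral L_def p_def q_def w_def Z_def
          distrib_left)
  qed
  have gap: "p \<le> q - 2" if "p < q" using that ev(3,4) by presburger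
  have gap': "q \<le> p - 2" if "q < p" using that ev(3,4) by presburger
  have ge2: "2 \<le> x" if "0 < x" "even x" for x :: int using that by presburger
  have prod: "2*a \<le> a*x" if "0 \<le> a" "2 \<le> x" for a x :: int
    using mult_left_mono[OF that(2,1)] by (simp add: mult.commute)
  \<comment> \<open>Linear arithmetic sees the products as atoms; the next four facts bound them
    below, already combined with the linear terms that occur in the cases.\<close>
  have mx: "2*m \<le> m*x" if "2 \<le> x" for x
    using prod[of m x] mL that by simp
  have mw: "2*m - 2 \<le> m*w - w" if "2 \<le> w"
    using prod[of "m - 1" w] mL that by (simp add: algebra_simps)
  have Lq: "2*L - 6 \<le> L*q - 3*q" if "2 \<le> q"
    using prod[of "L - 3" q] mL that by (simp add: algebra_simps)
  have Lx: "2*L - 2 \<le> L*x - x" if "2 \<le> x" for x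
    using prod[of "L - 1" x] mL that by (simp add: algebra_simps)
  have mono: "0 \<le> L*p" "3*q \<le> L*q" "p \<ge> q \<Longrightarrow> L*q \<le> L*p"
    using mL nonneg by (auto intro: mult_mono)
  have "k \<le> Y + Z"
    using par
  proof (elim disjE conjE)
    assume odd: "odd d1" "odd d2"
    show ?thesis
    proof (cases "u = 0")
      case False
      then have "2 \<le> u" using nonneg(1) ev(1) ge2[of u] by linarith
      from mx[OF this] show ?thesis using Y1 nonneg mL by linarith
    next
      case True
      have "w \<noteq> 0" using True odd by (auto simp: defs)
      then have w: "2 \<le> w" using nonneg(2) ev(2) ge2[of w] by linarith
      show ?thesis
      proof (cases "p < q")
        case True
        then have "2 \<le> q" using nonneg gap by linarith
        from Lq[OF this] show ?thesis using Y2 Z2 mw[OF w] gap[OF True] mL by linarith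
      next
        case False
        then have "L*q \<le> L*p" using mono(3) by simp
        then show ?thesis using Y2 Z1 mx[OF w] mono(1,2) mL by linarith
      qed
    qed
  next
    assume odd: "odd d3" "odd d4"
    \<comment> \<open>Equality would force \<open>d3 = 0\<close> or \<open>d4 = 0\<close>, contrary
      to oddness.\<close>
    then have "p \<noteq> q" by (auto simp: defs abs_eq_iff)
    then consider "q < p" | "p < q" by linarith
    then show ?thesis
    proof cases
      case 1
      then have "2 \<le> p" using nonneg gap' by linarith
      from Lx[OF this] show ?thesis using Z1 gap'[OF 1] nonneg mL by linarith
    next
      case 2
      have q: "2 \<le> q" using nonneg gap[OF 2] by linarith
      show ?thesis
      proof (cases "w = 0")
        case True
        then show ?thesis using Z2 Lx[OF q] gap[OF 2] nonneg mL by linarith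
      next
        case False
        then have "2 \<le> w" using nonneg(2) ev(2) ge2[of w] by linarith
        from mw[OF this] show ?thesis using Y2 Z2 Lq[OF q] gap[OF 2] mL by linarith
      qed
    qed
  qed
  then show ?thesis by (simp add: Y_def Z_def)
qed

text \<open>Half-integral coordinates with respect to \<open>e1\<close>, ..., \<open>e4\<close>
  reduce this to \<open>half_lattice_norm_ge\<close>, whose estimates need
  \<open>M \<noteq> 1\<close>.\<close>

lemma far_coset_norm_ge:
  fixes M k y1 y2 y3 y4 :: int
  assumes M: "1 \<le> M \<and> k = 2*M \<or> M \<le> -2 \<and> k = -2*M - 1"
    and cong: "[circ_val M y1 y2 y3 y4 = circ_val M M M 0 0] (mod circ_order M)"
  shows "k \<le> \<bar>y1\<bar> + \<bar>y2\<bar> + \<bar>y3\<bar> + \<bar>y4\<bar>"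
proof -
  obtain t where t: "circ_val M y1 y2 y3 y4 - circ_val M M M 0 0 = circ_order M * t"
    using cong by (auto simp: cong_iff_dvd_diff)
  show ?thesis
  proof (cases "M = 1")
    case True
    with M have "k = 2" by auto
    from t True have "y1 + 15*y2 + 4*y3 + 6*y4 - 16 = 32*t"
      by (simp add: circ_val_def circ_order_def)
    moreover have "\<bar>y1 + 15*y2 + 4*y3 + 6*y4\<bar> \<le> 15*(\<bar>y1\<bar> + \<bar>y2\<bar> + \<bar>y3\<bar> + \<bar>y4\<bar>)"
      by (smt (verit))
    ultimately have "\<not> \<bar>y1\<bar> + \<bar>y2\<bar> + \<bar>y3\<bar> + \<bar>y4\<bar> \<le> 1"
      by (cases "t \<le> -1") linarith+
    with \<open>k = 2\<close> show ?thesis by linarith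
  next
    case False
    have "circ_val M (y1 - M) (y2 - M) y3 y4 = circ_order M * t"
      using t by (simp add: circ_val_def algebra_simps)
    then obtain c1 c2 c3 c4 where c:
      "y1 - M = 2*M*c1 - c3 + M*c4" "y2 - M = 2*M*c2 + c3 + M*c4"
      "y3 = c1 - c2 + (2*M + 1)*c3 + M*c4" "y4 = - c1 + c2 + c3 + (M + 1)*c4"
      by (rule kernel_coefficients)
    show ?thesis
    proof (rule half_lattice_norm_ge)
      show "2 \<le> M \<and> k = 2*M \<or> M \<le> -2 \<and> k = -2*M - 1" using M False by auto
      \<comment> \<open>Since \<open>h\<close> is half the sum of the \<open>e_i\<close>, each
        \<open>d_i\<close> receives \<open>c4\<close>; the offset \<open>(e1 + e2)/2\<close> adds 1
        to \<open>d1\<close> and \<open>d2\<close> only. This yields the opposite parities.\<close>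
      show "2*y1 = 2*M*(2*c1 + c4 + 1) - (2*c3 + c4) + c4" using c(1) by algebra
      show "2*y2 = 2*M*(2*c2 + c4 + 1) + (2*c3 + c4) - c4" using c(2) by algebra
      show "2*y3 = (2*c1 + c4 + 1) - (2*c2 + c4 + 1) + (2*M + 1)*(2*c3 + c4) - c4"
        using c(3) by algebra
      show "2*y4 = (2*c2 + c4 + 1) - (2*c1 + c4 + 1) + (2*c3 + c4) + (2*M + 1)*c4"
        using c(4) by algebra
    qed auto
  qed
qed

section \<open>Upper bound: the covering radius\<close>

text \<open>The hypothesis \<open>min\<close> puts the point in the \<open>l1\<close> Voronoi cell
  of the origin. For numerical \<open>c_i\<close> each instance is linear in \<open>M\<close> and
  the \<open>x_i\<close> apart from absolute values, so finitely many instances settle all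
  \<open>M\<close> at once by linear arithmetic.\<close>

lemma minimal_representative_norm_le:
  fixes M k x1 x2 x3 x4 :: int
  assumes M: "1 \<le> M \<and> k = 2*M \<or> M \<le> -2 \<and> k = -2*M - 1"
    and min: "\<And>c1 c2 c3 c4. \<bar>x1\<bar> + \<bar>x2\<bar> + \<bar>x3\<bar> + \<bar>x4\<bar>
      \<le> \<bar>x1 + 2*M*c1 - c3 + M*c4\<bar> + \<bar>x2 + 2*M*c2 + c3 + M*c4\<bar>
        + \<bar>x3 + c1 - c2 + (2*M + 1)*c3 + M*c4\<bar> + \<bar>x4 - c1 + c2 + c3 + (M + 1)*c4\<bar>"
  shows "\<bar>x1\<bar> + \<bar>x2\<bar> + \<bar>x3\<bar> + \<bar>x4\<bar> \<le> k"
proof -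
  \<comment> \<open>the translations by \<open>\<plusminus>e_i\<close> and \<open>(\<plusminus>e1 \<plusminus> e2 \<plusminus> e3 \<plusminus> e4)/2\<close>; of those added below, the ones with a
    coefficient \<open>\<plusminus>3/2\<close> are needed only for \<open>k = 2\<close> and \<open>k = 3\<close>\<close>
  note cell =
      min[of 1 0 0 0, simplified] min[of "-1" 0 0 0, simplified]
      min[of 0 0 0 1, simplified] min[of 0 0 0 "-1", simplified]
      min[of 0 1 0 0, simplified] min[of 0 "-1" 0 0, simplified]
      \<comment> \<open>Arguments of \<open>of\<close> follow the order of occurrence
        \<open>c1\<close>, \<open>c3\<close>, \<open>c4\<close>, \<open>c2\<close>; this pair is
        \<open>e4 = 2*h - e1 - e2 - e3\<close> and its negative.\<close>
      min[of "-1" "-1" 2 "-1", simplified] min[of 1 1 "-2" 1, simplified]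
      min[of 0 0 1 0, simplified] min[of 1 1 "-1" 1, simplified]
      min[of 0 "-1" 1 0, simplified] min[of 1 0 "-1" 1, simplified]
      min[of 0 0 1 "-1", simplified] min[of 1 1 "-1" 0, simplified]
      min[of 0 "-1" 1 "-1", simplified] min[of 1 0 "-1" 0, simplified]
      min[of "-1" 0 1 0, simplified] min[of 0 1 "-1" 1, simplified]
      min[of "-1" "-1" 1 0, simplified] min[of 0 0 "-1" 1, simplified]
      min[of "-1" 0 1 "-1", simplified] min[of 0 1 "-1" 0, simplified]
      min[of "-1" "-1" 1 "-1", simplified] min[of 0 0 "-1" 0, simplified]
  from M show ?thesis
  proof (elim disjE conjE)
    assume "1 \<le> M" "k = 2*M"
    with cell
      \<comment> \<open>The vectors \<open>e1 + e2\<close> and \<open>-(e1 + e2)\<close>, of norm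
        exactly \<open>2*k\<close> for even \<open>k\<close>.\<close>
      min[of 1 0 0 1, simplified] min[of "-1" 0 0 "-1", simplified]
      min[of 1 1 "-1" 2, simplified] min[of "-1" "-1" 1 "-2", simplified]
      min[of 1 "-1" 1 0, simplified] min[of "-1" 1 "-1" 0, simplified]
    show ?thesis by (smt (verit))
  next
    assume "M \<le> -2" "k = -2*M - 1"
    with cell
      \<comment> \<open>For odd \<open>k\<close> the vectors of norm \<open>2*k\<close> are instead
        \<open>e3 + e4 = (0, 0, 2*M, 2*M + 2)\<close> and its negative.\<close>
      min[of "-1" 0 2 "-1", simplified] min[of 1 0 "-2" 1, simplified]
      min[of "-1" "-2" 3 "-2", simplified] min[of 1 2 "-3" 2, simplified]
    show ?thesis by (smt (verit))
  qed
qed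

text \<open>A vector of least norm representing \<open>z\<close> exists by well-ordering, and all
  its lattice translates represent \<open>z\<close> too, so it satisfies the minimality
  hypothesis.\<close>

lemma circ_val_covering:
  fixes M k z :: int
  assumes M: "1 \<le> M \<and> k = 2*M \<or> M \<le> -2 \<and> k = -2*M - 1"
  obtains x1 x2 x3 x4 where "\<bar>x1\<bar> + \<bar>x2\<bar> + \<bar>x3\<bar> + \<bar>x4\<bar> \<le> k"
    "[z = circ_val M x1 x2 x3 x4] (mod circ_order M)"
proof -
  define P where "P = (\<lambda>(x1, x2, x3, x4). [z = circ_val M x1 x2 x3 x4] (mod circ_order M))"
  define norm where "norm = (\<lambda>(x1, x2, x3, x4). nat (\<bar>x1\<bar> + \<bar>x2\<bar> + \<bar>x3\<bar> + \<bar>x4\<bar> :: int))"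
  have "P (z, 0, 0, 0)" by (simp add: P_def circ_val_def)
  then obtain x where x: "P x" and least: "\<forall>y. P y \<longrightarrow> norm x \<le> norm y"
    using ex_has_least_nat[of P _ norm] by blast
  obtain x1 x2 x3 x4 where xs: "x = (x1, x2, x3, x4)" by (cases x)
  have "\<bar>x1\<bar> + \<bar>x2\<bar> + \<bar>x3\<bar> + \<bar>x4\<bar> \<le> k"
  proof (rule minimal_representative_norm_le[OF M])
    fix c1 c2 c3 c4
    let ?y = "(x1 + 2*M*c1 - c3 + M*c4, x2 + 2*M*c2 + c3 + M*c4,
      x3 + c1 - c2 + (2*M + 1)*c3 + M*c4, x4 - c1 + c2 + c3 + (M + 1)*c4)"
    have "P ?y"
      using x by (simp add: P_def xs circ_val_shift cong_def)
    then have "norm x \<le> norm ?y" using least by blast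
    then show "\<bar>x1\<bar> + \<bar>x2\<bar> + \<bar>x3\<bar> + \<bar>x4\<bar>
      \<le> \<bar>x1 + 2*M*c1 - c3 + M*c4\<bar> + \<bar>x2 + 2*M*c2 + c3 + M*c4\<bar>
        + \<bar>x3 + c1 - c2 + (2*M + 1)*c3 + M*c4\<bar> + \<bar>x4 - c1 + c2 + c3 + (M + 1)*c4\<bar>"
      by (simp add: norm_def xs nat_le_eq_zle add_nonneg_nonneg)
  qed
  moreover have "[z = circ_val M x1 x2 x3 x4] (mod circ_order M)"
    using x by (simp add: P_def xs)
  ultimately show thesis by (rule that)
qed

section \<open>From the lattice to the circulant graphs\<close>

text \<open>The sign \<open>s\<close> absorbs the difference between the two parities: flipping
  three coordinates preserves the \<open>l1\<close> norm.\<close>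

lemma graph_diameter_circ:
  fixes M s g2 g3 g4 :: int and k n :: nat
  assumes M: "1 \<le> M \<and> int k = 2*M \<or> M \<le> -2 \<and> int k = -2*M - 1"
    and n: "0 < n" "int n = circ_order M"
    and s: "s * s = 1"
    and range: "{1, g2, g3, g4} \<subseteq> {0..<int n}" and distinct: "distinct [1, g2, g3, g4]"
    and g: "[g2 = s * circ_val M 0 1 0 0] (mod int n)" "[g3 = s * circ_val M 0 0 1 0] (mod int n)"
      "[g4 = s * circ_val M 0 0 0 1] (mod int n)"
  shows "graph_diameter (cayley_graph (integer_mod_group n) {1, g2, g3, g4}) = ereal (real k)"
proof -
  have sum4: "(\<Sum>h\<in>{1, g2, g3, g4}. f h) = f 1 + f g2 + f g3 + f g4" for f :: "int \<Rightarrow> int"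
    using distinct by (simp add: add.assoc)
  have "\<bar>s\<bar> = 1" using s by (auto simp: zmult_eq_1_iff)
  then have abs_s: "\<bar>s * x\<bar> = \<bar>x\<bar>" for x by (simp add: abs_mult)
  have val: "[(\<Sum>h\<in>{1, g2, g3, g4}. c h * h) = circ_val M (c 1) (s * c g2) (s * c g3) (s * c g4)]
    (mod int n)" for c
  proof -
    have "[c 1 * 1 + c g2 * g2 + c g3 * g3 + c g4 * g4 =
        c 1 * 1 + c g2 * (s * circ_val M 0 1 0 0) + c g3 * (s * circ_val M 0 0 1 0)
          + c g4 * (s * circ_val M 0 0 0 1)] (mod int n)"
      by (intro cong_add cong_mult cong_refl g)
    also have "c 1 * 1 + c g2 * (s * circ_val M 0 1 0 0) + c g3 * (s * circ_val M 0 0 1 0)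
          + c g4 * (s * circ_val M 0 0 0 1) = circ_val M (c 1) (s * c g2) (s * c g3) (s * c g4)"
      by (simp add: circ_val_def algebra_simps)
    finally show ?thesis unfolding sum4 .
  qed
  show ?thesis
  proof (rule graph_diameter_circulantI[OF n(1) range])
    fix z
    obtain x1 x2 x3 x4 where x: "\<bar>x1\<bar> + \<bar>x2\<bar> + \<bar>x3\<bar> + \<bar>x4\<bar> \<le> int k"
      "[z = circ_val M x1 x2 x3 x4] (mod int n)"
      using circ_val_covering[OF M, of z] n(2) by metis
    define c where "c = (\<lambda>_. 0)(1 := x1, g2 := s * x2, g3 := s * x3, g4 := s * x4)"
    have c: "c 1 = x1" "c g2 = s * x2" "c g3 = s * x3" "c g4 = s * x4"
      using distinct by (auto simp: c_def)
    have "[z = (\<Sum>h\<in>{1, g2, g3, g4}. c h * h)] (mod int n)"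
      using x(2) val[of c] s by (simp add: c mult.assoc[symmetric] cong_def del: sum.insert)
    moreover have "(\<Sum>h\<in>{1, g2, g3, g4}. \<bar>c h\<bar>) \<le> int k"
      unfolding sum4 using x(1) by (simp add: c abs_s)
    ultimately show "\<exists>c. (\<Sum>g\<in>{1, g2, g3, g4}. \<bar>c g\<bar>) \<le> int k \<and>
        [z = (\<Sum>g\<in>{1, g2, g3, g4}. c g * g)] (mod int n)"
      by blast
  next
    fix c :: "int \<Rightarrow> int"
    assume "[circ_val M M M 0 0 = (\<Sum>g\<in>{1, g2, g3, g4}. c g * g)] (mod int n)"
    then have "[circ_val M (c 1) (s * c g2) (s * c g3) (s * c g4) = circ_val M M M 0 0]
        (mod circ_order M)"
      using val[of c] unfolding n(2)[symmetric] by (meson cong_sym cong_trans)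
    from far_coset_norm_ge[OF M this]
    show "int k \<le> (\<Sum>g\<in>{1, g2, g3, g4}. \<bar>c g\<bar>)"
      unfolding sum4 by (simp add: abs_s)
  qed
qed

lemma cyclic_integer_mod_group: "cyclic_group (integer_mod_group n)"
proof -
  interpret group "integer_mod_group n" by simp
  have "\<exists>x. x \<in> carrier (integer_mod_group n) \<and>
      carrier (integer_mod_group n) = range (\<lambda>i::int. (i * x) mod int n)"
  \<comment> \<open>In the trivial group the carrier is \<open>{0}\<close>, so 1 cannot serve as the
    generator.\<close>
  proof (cases "n = 1")
    case True
    then show ?thesis by (intro exI[of _ 0]) (auto simp: carrier_integer_mod_group)
  next
    case False
    have "carrier (integer_mod_group n) = range (\<lambda>i::int. (i * 1) mod int n)"
    proof (cases "n = 0")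
      case False
      show ?thesis
      proof (intro subset_antisym subsetI)
        fix i assume "i \<in> carrier (integer_mod_group n)"
        then have "i = (i * 1) mod int n" using \<open>n \<noteq> 0\<close> by (simp add: carrier_integer_mod_group)
        then show "i \<in> range (\<lambda>i::int. (i * 1) mod int n)" by blast
      qed (use \<open>n \<noteq> 0\<close> in \<open>auto simp: carrier_integer_mod_group\<close>)
    qed (simp add: carrier_integer_mod_group)
    moreover have "1 \<in> carrier (integer_mod_group n)" using False by simp
    ultimately show ?thesis by blast
  qed
  then show ?thesis
    unfolding cyclic_group int_pow_integer_mod_group by blast
qed

lemma gens8_L8_circulant:
  assumes "k \<ge> 2"
  shows "gens8 k \<subseteq> {0..<int (L8 k)}" "card (gens8 k) = 4" "0 < L8 k"
    "graph_diameter (cayley_graph (integer_mod_group (L8 k)) (gens8 k)) = ereal (real k)"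
proof -
  have "\<exists>M s g2 g3 g4. (1 \<le> M \<and> int k = 2*M \<or> M \<le> -2 \<and> int k = -2*M - 1) \<and>
    0 < L8 k \<and> int (L8 k) = circ_order M \<and> s * s = 1 \<and>
    {1, g2, g3, g4} \<subseteq> {0..<int (L8 k)} \<and> distinct [1, g2, g3, g4] \<and>
    [g2 = s * circ_val M 0 1 0 0] (mod int (L8 k)) \<and> [g3 = s * circ_val M 0 0 1 0] (mod int (L8 k)) \<and>
    [g4 = s * circ_val M 0 0 0 1] (mod int (L8 k)) \<and> gens8 k = {1, g2, g3, g4}"
  proof (cases "even k")
    case True
    then obtain j where j: "k = 2*j" ..
    define M where "M = int j"
    have M: "1 \<le> M" "int k = 2*M" using assms by (auto simp: M_def j)
    \<comment> \<open>This chain makes the polynomial inequalities below linear in the powers of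
      \<open>M\<close>.\<close>
    have pow: "M \<le> M^2" "M^2 \<le> M^3" "M^3 \<le> M^4"
      using M(1) power_increasing[of 1 2 M] power_increasing[of 2 3 M] power_increasing[of 3 4 M]
      by auto
    have "2 * int (L8 k) = 2 * circ_order M"
    proof -
      have "2 * int (L8 k) = (int k)^4 + 2*(int k)^3 + 6*(int k)^2 + 4*int k"
        using arg_cong[OF L8_exact[of k], of int] True by simp
      then show ?thesis unfolding M(2) circ_order_def by algebra
    qed
    then have L: "int (L8 k) = 8*M^4 + 8*M^3 + 12*M^2 + 4*M" by (simp add: circ_order_def)
    define g2 g3 g4 where "g2 = 4*M^3 + 4*M^2 + 6*M + 1"
      and "g3 = 4*M^4 + 4*M^2 - 4*M" and "g4 = 4*M^4 + 4*M^2 - 2*M"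
    have e: "(2*M)^3 + 2*(2*M)^2 + 6*(2*M) + 2 = 2*g2"
      "(2*M)^4 + 4*(2*M)^2 - 8*(2*M) = 4*g3" "(2*M)^4 + 4*(2*M)^2 - 4*(2*M) = 4*g4"
      unfolding g2_def g3_def g4_def by algebra+
    have "gens8 k = {1, g2, g3, g4}"
      unfolding gens8_def Let_def M(2) e by simp
    moreover have "distinct [1, g2, g3, g4]"
    proof -
      have "odd g2" "even g3" "even g4" by (simp_all add: g2_def g3_def g4_def)
      moreover have "1 < g2" "g3 < g4" using M pow unfolding g2_def g3_def g4_def by linarith+
      ultimately show ?thesis by auto
    qed
    moreover have "{1, g2, g3, g4} \<subseteq> {0..<int (L8 k)}"
      using M pow unfolding L g2_def g3_def g4_def by auto
    moreover have "0 < L8 k" using L M pow by linarith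
    moreover have "[g2 = 1 * circ_val M 0 1 0 0] (mod int (L8 k))"
      "[g3 = 1 * circ_val M 0 0 1 0] (mod int (L8 k))" "[g4 = 1 * circ_val M 0 0 0 1] (mod int (L8 k))"
      by (simp_all add: g2_def g3_def g4_def circ_val_def)
    moreover have "int (L8 k) = circ_order M" using L by (simp add: circ_order_def)
    ultimately show ?thesis using M by (metis mult_1)
  next
    case False
    then obtain j where j: "k = 2*j + 1" by (rule oddE)
    define m where "m = int j"
    have m: "1 \<le> m" "int k = 2*m + 1" using assms by (auto simp: m_def j)
    have pow: "m \<le> m^2" "m^2 \<le> m^3" "m^3 \<le> m^4"
      using m(1) power_increasing[of 1 2 m] power_increasing[of 2 3 m] power_increasing[of 3 4 m]
      by auto
    have "2 * int (L8 k) = 2 * (8*m^4 + 24*m^3 + 36*m^2 + 28*m + 8)"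
    proof -
      have "2 * int (L8 k) = (int k)^4 + 2*(int k)^3 + 6*(int k)^2 + 6*int k + 1"
        using arg_cong[OF L8_exact[of k], of int] False by simp
      then show ?thesis unfolding m(2) by algebra
    qed
    then have L: "int (L8 k) = 8*m^4 + 24*m^3 + 36*m^2 + 28*m + 8" by simp
    define g2 g3 g4 where "g2 = 4*m^3 + 8*m^2 + 10*m + 5"
      and "g3 = 4*m^4 + 8*m^3 + 8*m^2 - 4" and "g4 = 4*m^4 + 8*m^3 + 8*m^2 + 2*m - 2"
    have e: "(2*m + 1)^3 + (2*m + 1)^2 + 5*(2*m + 1) + 3 = 2*g2"
      "(2*m + 1)^4 + 2*(2*m + 1)^2 - 8*(2*m + 1) - 11 = 4*g3"
      "(2*m + 1)^4 + 2*(2*m + 1)^2 - 4*(2*m + 1) - 7 = 4*g4"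
      unfolding g2_def g3_def g4_def by algebra+
    have "gens8 k = {1, g2, g3, g4}"
      unfolding gens8_def Let_def m(2) e by simp
    moreover have "distinct [1, g2, g3, g4]"
    proof -
      have "odd g2" "even g3" "even g4" by (simp_all add: g2_def g3_def g4_def)
      moreover have "1 < g2" "g3 < g4" using m pow unfolding g2_def g3_def g4_def by linarith+
      ultimately show ?thesis by auto
    qed
    moreover have "{1, g2, g3, g4} \<subseteq> {0..<int (L8 k)}"
      using m pow unfolding L g2_def g3_def g4_def by auto
    moreover have "0 < L8 k" using L m pow by linarith
    \<comment> \<open>Here \<open>M = -(k + 1)/2 = - m - 1\<close>, and the sign is
      \<open>s = -1\<close>.\<close>
    moreover have ord: "int (L8 k) = circ_order (- m - 1)"
      unfolding L circ_order_def by algebra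
    moreover have "[g2 = -1 * circ_val (- m - 1) 0 1 0 0] (mod int (L8 k))"
    proof -
      have "g2 = -1 * circ_val (- m - 1) 0 1 0 0" unfolding g2_def circ_val_def by algebra
      then show ?thesis by simp
    qed
    moreover have "[g3 = -1 * circ_val (- m - 1) 0 0 1 0] (mod int (L8 k))"
    proof -
      \<comment> \<open>The negated polynomial has leading term \<open>-4*m^4\<close>; adding the
        order once gives the listed generator.\<close>
      have "g3 = -1 * circ_val (- m - 1) 0 0 1 0 + int (L8 k)"
        unfolding g3_def L circ_val_def by algebra
      then show ?thesis by (simp add: cong_def)
    qed
    moreover have "[g4 = -1 * circ_val (- m - 1) 0 0 0 1] (mod int (L8 k))"
    proof -
      have "g4 = -1 * circ_val (- m - 1) 0 0 0 1 + int (L8 k)"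
        unfolding g4_def L circ_val_def by algebra
      then show ?thesis by (simp add: cong_def)
    qed
    moreover have "- m - 1 \<le> -2 \<and> int k = -2*(- m - 1) - 1" using m by simp
    moreover have "(-1) * (-1) = (1::int)" by simp
    ultimately show ?thesis by blast
  qed
  then obtain M s g2 g3 g4 where
    *: "1 \<le> M \<and> int k = 2*M \<or> M \<le> -2 \<and> int k = -2*M - 1" "0 < L8 k" "int (L8 k) = circ_order M"
      "s * s = 1" "{1, g2, g3, g4} \<subseteq> {0..<int (L8 k)}" "distinct [1, g2, g3, g4]"
      "[g2 = s * circ_val M 0 1 0 0] (mod int (L8 k))" "[g3 = s * circ_val M 0 0 1 0] (mod int (L8 k))"
      "[g4 = s * circ_val M 0 0 0 1] (mod int (L8 k))"
    and S: "gens8 k = {1, g2, g3, g4}" by blast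
  show "graph_diameter (cayley_graph (integer_mod_group (L8 k)) (gens8 k)) = ereal (real k)"
    unfolding S by (rule graph_diameter_circ[OF *])
  show "gens8 k \<subseteq> {0..<int (L8 k)}" "0 < L8 k" unfolding S by (fact *)+
  show "card (gens8 k) = 4" unfolding S using *(6) by simp
qed

theorem theorem1:
  fixes k :: nat
  assumes "k \<ge> 2"
  shows "(\<exists>(G :: int monoid) S.
            group G \<and> cyclic_group G \<and> S \<subseteq> carrier G \<and> card S = 4 \<and>
            graph_diameter (cayley_graph G S) = ereal (real k) \<and>
            card (verts (cayley_graph G S)) = L8 k) \<and>
         gens8 k \<subseteq> carrier (integer_mod_group (L8 k)) \<and> card (gens8 k) = 4 \<and>
         graph_diameter (cayley_graph (integer_mod_group (L8 k)) (gens8 k)) = ereal (real k) \<and>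
         card (verts (cayley_graph (integer_mod_group (L8 k)) (gens8 k))) = L8 k"
proof -
  note props = gens8_L8_circulant[OF assms]
  have carrier: "carrier (integer_mod_group (L8 k)) = {0..<int (L8 k)}"
    using props(3) by (simp add: carrier_integer_mod_group)
  then have "card (verts (cayley_graph (integer_mod_group (L8 k)) (gens8 k))) = L8 k"
    by (simp add: cayley_graph_sel)
  with props carrier cyclic_integer_mod_group[of "L8 k"] group_integer_mod_group[of "L8 k"]
  show ?thesis by metis
qed

end
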